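(* Let $X$ be a topological vector space possessing a countable base of neighborhoods of zero (in other words, $X$ is metrizable). Then the following assertions are equivalent: (i) $X$ is complete. (ii) $X \in \mathrm{Compl}(\mathcal F)$ for every free filter $\mathcal F$ on $\mathbb N$. (iii) There is a free filter $\mathcal F$ on $\mathbb N$ such that $X \in \mathrm{Compl}(\mathcal F)$. (iv) $X$ is sequentially complete.
   Context: "Topological vector space" (TVS) means a Hausdorff topological vector space over $\mathbb K \in \{\mathbb R, \mathbb C\}$. Filters are proper (they do not contain $\emptyset$). A filter on $\mathbb N$ is free if it contains the Fréchet filter $\mathfrak{Fr} = \{A \subset \mathbb N : |\mathbb N \setminus A| < \infty\}$. A point $z$ is a limit of a filter $\mathcal G$ on a topological space if every neighborhood of $z$ belongs to $\mathcal G$. A filter $\mathcal G$ on a TVS $X$ is Cauchy if for every neighborhood $U$ of $0$ there is $A \in \mathcal G$ with $A - A \subset U$. $X$ is complete if every Cauchy filter on $X$ has a limit. For a filter $\mathcal F$ on $\mathbb N$, a sequence $(x_n) \subset X$ is a Cauchy sequence over $\mathcal F$ if for every neighborhood $U$ of $0$ there is $B \in \mathcal F$ with $x_n - x_m \in U$ for all $n,m \in B$; it has limit $y \in X$ over $\mathcal F$ if for every neighborhood $V$ of $y$ there is $B \in \mathcal F$ with $x_n \in V$ for all $n \in B$. $X$ is complete over $\mathcal F$, written $X \in \mathrm{Compl}(\mathcal F)$, if every Cauchy sequence over $\mathcal F$ in $X$ has a limit over $\mathcal F$ in $X$. $X$ is sequentially complete if $X \in \mathrm{Compl}(\mathfrak{Fr})$,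 i.e. every ordinary Cauchy sequence in $X$ converges. *)

theory Defs
  imports Complex_Main "HOL-Library.Countable_Set"
begin

text \<open>
  Scalars are taken from a type of class \<^class>\<open>real_normed_field\<close>, equipped with its norm topology.
  The norm of such a field is multiplicative, so by the Gelfand--Mazur theorem it is isometrically
  isomorphic to the real or to the complex numbers. Both \<^typ>\<open>real\<close> and \<^typ>\<open>complex\<close> are instances.
  The vector space is a whole type; the Hausdorff property is the class \<^class>\<open>t2_space\<close>, and joint
  continuity of addition is part of \<^class>\<open>topological_ab_group_add\<close>.
\<close>

locale topological_vector_space = vector_space scale
  for scale :: "'k::real_normed_field \<Rightarrow> 'a::{t2_space, topological_ab_group_add} \<Rightarrow> 'a" +
  assumes continuous_scale: "continuous_on UNIV (\<lambda>(c, x). scale c x)"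

definition neighborhood :: "'a::topological_space \<Rightarrow> 'a set \<Rightarrow> bool" where
  "neighborhood z U \<longleftrightarrow> (\<exists>W. open W \<and> z \<in> W \<and> W \<subseteq> U)"

definition countable_base_at_zero :: "'a::{topological_space, zero} itself \<Rightarrow> bool" where
  "countable_base_at_zero _ \<longleftrightarrow>
    (\<exists>\<B> :: 'a set set. countable \<B> \<and> (\<forall>B\<in>\<B>. neighborhood 0 B) \<and>
      (\<forall>U. neighborhood 0 U \<longrightarrow> (\<exists>B\<in>\<B>. B \<subseteq> U)))"

text \<open>
  A set \<open>A\<close> belongs to a filter \<open>G\<close> iff \<open>\<forall>\<^sub>F x in G. x \<in> A\<close>. Filters of type \<^typ>\<open>'a filter\<close> may be
  improper (\<^term>\<open>bot\<close>), so properness is required explicitly; the inclusion of filters as set families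
  is the reverse of the library order.
\<close>

definition filter_limit :: "'a::topological_space filter \<Rightarrow> 'a \<Rightarrow> bool" where
  "filter_limit G z \<longleftrightarrow> (\<forall>U. neighborhood z U \<longrightarrow> (\<forall>\<^sub>F x in G. x \<in> U))"

definition tvs_cauchy_filter :: "'a::topological_ab_group_add filter \<Rightarrow> bool" where
  "tvs_cauchy_filter G \<longleftrightarrow>
    (\<forall>U. neighborhood 0 U \<longrightarrow>
      (\<exists>A. (\<forall>\<^sub>F x in G. x \<in> A) \<and> {a - b | a b. a \<in> A \<and> b \<in> A} \<subseteq> U))"

definition tvs_complete :: "'a::topological_ab_group_add itself \<Rightarrow> bool" where
  "tvs_complete _ \<longleftrightarrow>
    (\<forall>G :: 'a filter. G \<noteq> bot \<longrightarrow> tvs_cauchy_filter G \<longrightarrow> (\<exists>z. filter_limit G z))"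

abbreviation frechet_filter :: "nat filter" where
  "frechet_filter \<equiv> cofinite"

definition free_filter :: "nat filter \<Rightarrow> bool" where
  "free_filter F \<longleftrightarrow> F \<noteq> bot \<and> F \<le> frechet_filter"

definition cauchy_over :: "nat filter \<Rightarrow> (nat \<Rightarrow> 'a::topological_ab_group_add) \<Rightarrow> bool" where
  "cauchy_over F x \<longleftrightarrow>
    (\<forall>U. neighborhood 0 U \<longrightarrow>
      (\<exists>B. (\<forall>\<^sub>F n in F. n \<in> B) \<and> (\<forall>n\<in>B. \<forall>m\<in>B. x n - x m \<in> U)))"

definition limit_over :: "nat filter \<Rightarrow> (nat \<Rightarrow> 'a::topological_space) \<Rightarrow> 'a \<Rightarrow> bool" where
  "limit_over F x y \<longleftrightarrow>
    (\<forall>V. neighborhood y V \<longrightarrow> (\<exists>B. (\<forall>\<^sub>F n in F. n \<in> B) \<and> (\<forall>n\<in>B. x n \<in> V)))"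

definition complete_over :: "'a::topological_ab_group_add itself \<Rightarrow> nat filter \<Rightarrow> bool" where
  "complete_over _ F \<longleftrightarrow>
    (\<forall>x :: nat \<Rightarrow> 'a. cauchy_over F x \<longrightarrow> (\<exists>y. limit_over F x y))"

definition sequentially_complete :: "'a::topological_ab_group_add itself \<Rightarrow> bool" where
  "sequentially_complete X \<longleftrightarrow> complete_over X frechet_filter"

end

theory Submission
  imports Defs
begin

text \<open>
  Everything is read off the image filters \<open>filtermap x F\<close>: a sequence is Cauchy over \<open>F\<close>, or has a
  limit over \<open>F\<close>, exactly when its image filter is Cauchy, or has that limit. The key fact is that
  a Cauchy filter converges as soon as some proper finer filter does
  (\<open>cauchy_filter_limit_of_finer\<close>): in a Cauchy filter all points of a small member are close to
  each other, and one of them is close to the limit of the finer filter.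

  Completeness gives completeness over every \<open>F\<close> by applying it to the image filter. If the space is
  complete over one free \<open>F\<close>, then an ordinary Cauchy sequence converges over \<open>F\<close>, and its image of
  \<open>F\<close> is finer than its image of the Frechet filter, so it converges in the ordinary sense.

  The countable base enters in the passage from sequential completeness to completeness. For a proper
  Cauchy filter \<open>G\<close> choose one small member \<open>A n\<close> for each basic neighborhood. The coarser filter generated
  by these members is still Cauchy, and since it is countably generated it has a finer filter that
  comes from a sequence \<open>x n \<in> A 0 \<inter> \<dots> \<inter> A n\<close>. That sequence is Cauchy, so it converges; hence the
  generated filter converges, and so does \<open>G\<close>.
\<close>

lemma neighborhood_iff_eventually_nhds:
  "neighborhood z U \<longleftrightarrow> (\<forall>\<^sub>F x in nhds z. x \<in> U)"
  unfolding neighborhood_def eventually_nhds by blast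

lemma filter_limit_mono:
  assumes "H \<le> G" and "filter_limit G z"
  shows "filter_limit H z"
  using assms unfolding filter_limit_def by (meson filter_leD)

lemma tvs_cauchy_filter_mono:
  assumes "H \<le> G" and "tvs_cauchy_filter G"
  shows "tvs_cauchy_filter H"
  using assms unfolding tvs_cauchy_filter_def by (meson filter_leD)

text \<open>
  By continuity of addition at \<open>(0, y)\<close>, a point of \<open>V\<close> is obtained by adding a small vector to a point
  near \<open>y\<close>. A small member of \<open>G\<close> also belongs to \<open>H\<close>, so, \<open>H\<close> being proper, it contains some \<open>m\<close> near \<open>y\<close>;
  every other point \<open>a\<close> of it is then \<open>(a - m) + m\<close>.
\<close>

lemma cauchy_filter_limit_of_finer:
  fixes G H :: "'a::topological_ab_group_add filter"
  assumes cauchy: "tvs_cauchy_filter G"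
    and finer: "H \<le> G" and proper: "H \<noteq> bot"
    and limit: "filter_limit H y"
  shows "filter_limit G y"
  unfolding filter_limit_def
proof (intro allI impI)
  fix V :: "'a set"
  assume "neighborhood y V"
  then have "\<forall>\<^sub>F x in nhds (0 + y). x \<in> V"
    by (simp add: neighborhood_iff_eventually_nhds)
  then have "\<forall>\<^sub>F p in nhds 0 \<times>\<^sub>F nhds y. fst p + snd p \<in> V"
    using tendsto_add_Pair by (rule eventually_compose_filterlim)
  then obtain P Q where P: "eventually P (nhds 0)" and Q: "eventually Q (nhds y)"
    and PQ: "\<And>a b. P a \<Longrightarrow> Q b \<Longrightarrow> a + b \<in> V"
    unfolding eventually_prod_filter by auto
  have "neighborhood 0 {a. P a}"
    using P by (simp add: neighborhood_iff_eventually_nhds)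
  then obtain A where A: "\<forall>\<^sub>F x in G. x \<in> A" and small: "\<And>a b. a \<in> A \<Longrightarrow> b \<in> A \<Longrightarrow> P (a - b)"
    using cauchy[unfolded tvs_cauchy_filter_def, rule_format, of "{a. P a}"] by blast
  have "\<forall>\<^sub>F x in H. x \<in> A"
    using finer A by (rule filter_leD)
  moreover have "\<forall>\<^sub>F x in H. Q x"
    using limit[unfolded filter_limit_def, rule_format, of "{b. Q b}"] Q
    by (simp add: neighborhood_iff_eventually_nhds)
  ultimately have "\<forall>\<^sub>F x in H. x \<in> A \<and> Q x"
    by (rule eventually_conj)
  then obtain m where m: "m \<in> A" "Q m"
    using eventually_happens[of "\<lambda>x. x \<in> A \<and> Q x" H] proper by blast
  have "a \<in> V" if "a \<in> A" for a
    using PQ[OF small[OF that m(1)] m(2)] by simp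
  with A show "\<forall>\<^sub>F x in G. x \<in> V"
    by (auto elim: eventually_mono)
qed

lemma limit_over_iff_filter_limit:
  "limit_over F x y \<longleftrightarrow> filter_limit (filtermap x F) y"
proof -
  have "(\<exists>B. (\<forall>\<^sub>F n in F. n \<in> B) \<and> (\<forall>n\<in>B. x n \<in> V)) \<longleftrightarrow> (\<forall>\<^sub>F n in F. x n \<in> V)" for V
    by (auto elim: eventually_mono intro: exI[of _ "{n. x n \<in> V}"])
  then show ?thesis
    unfolding limit_over_def filter_limit_def eventually_filtermap by simp
qed

lemma cauchy_over_iff_tvs_cauchy_filter:
  "cauchy_over F x \<longleftrightarrow> tvs_cauchy_filter (filtermap x F)"
proof -
  have "(\<exists>B. (\<forall>\<^sub>F n in F. n \<in> B) \<and> (\<forall>n\<in>B. \<forall>m\<in>B. x n - x m \<in> U)) \<longleftrightarrow>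
      (\<exists>A. (\<forall>\<^sub>F n in F. x n \<in> A) \<and> {a - b | a b. a \<in> A \<and> b \<in> A} \<subseteq> U)"
    (is "?L \<longleftrightarrow> ?R") for U
  proof
    assume ?L
    then obtain B where "\<forall>\<^sub>F n in F. n \<in> B" and B: "\<forall>n\<in>B. \<forall>m\<in>B. x n - x m \<in> U"
      by blast
    then have "\<forall>\<^sub>F n in F. x n \<in> x ` B"
      by (auto elim: eventually_mono)
    moreover have "{a - b | a b. a \<in> x ` B \<and> b \<in> x ` B} \<subseteq> U"
      using B by blast
    ultimately show ?R
      by blast
  next
    assume ?R
    then obtain A where "\<forall>\<^sub>F n in F. x n \<in> A" "{a - b | a b. a \<in> A \<and> b \<in> A} \<subseteq> U"
      by blast
    then show ?L
      by (intro exI[of _ "{n. x n \<in> A}"]) auto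
  qed
  then show ?thesis
    unfolding cauchy_over_def tvs_cauchy_filter_def eventually_filtermap by simp
qed

lemma complete_over_iff:
  "complete_over TYPE('a::topological_ab_group_add) F \<longleftrightarrow>
    (\<forall>x :: nat \<Rightarrow> 'a. tvs_cauchy_filter (filtermap x F) \<longrightarrow> (\<exists>y. filter_limit (filtermap x F) y))"
  unfolding complete_over_def cauchy_over_iff_tvs_cauchy_filter limit_over_iff_filter_limit ..

lemma tvs_complete_imp_complete_over:
  assumes "tvs_complete TYPE('a::topological_ab_group_add)" and "F \<noteq> bot"
  shows "complete_over TYPE('a) F"
  using assms unfolding complete_over_iff tvs_complete_def by (simp add: filtermap_bot_iff)

text \<open>
  Completeness passes to a coarser index filter \<open>E\<close>: a Cauchy sequence over \<open>E\<close> is also Cauchy over \<open>F\<close>,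
  and its limit over \<open>F\<close> is a limit over \<open>E\<close> by \<open>cauchy_filter_limit_of_finer\<close>. The Frechet filter is
  the coarsest free filter, so sequential completeness is the weakest of these conditions.
\<close>

lemma complete_over_finer_imp_complete_over:
  assumes "complete_over TYPE('a::topological_ab_group_add) F"
    and "F \<le> E" and "F \<noteq> bot"
  shows "complete_over TYPE('a) E"
  unfolding complete_over_iff
proof (intro allI impI)
  fix x :: "nat \<Rightarrow> 'a"
  assume cauchy: "tvs_cauchy_filter (filtermap x E)"
  have finer: "filtermap x F \<le> filtermap x E"
    using assms(2) by (rule filtermap_mono)
  obtain y where "filter_limit (filtermap x F) y"
    using assms(1) tvs_cauchy_filter_mono[OF finer cauchy] unfolding complete_over_iff by blast
  then show "\<exists>y. filter_limit (filtermap x E) y"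
    using cauchy_filter_limit_of_finer[OF cauchy finer] assms(3)
    by (auto simp: filtermap_bot_iff)
qed

lemma free_filter_frechet: "free_filter frechet_filter"
  unfolding free_filter_def by simp

text \<open>
  This replaces a filter with countably many prescribed members by an ordinary sequence. The finite
  intersections of the \<open>A n\<close> are nonempty because they belong to a proper filter, and a sequence picked
  from the successive intersections is eventually in each \<open>A n\<close>.
\<close>

lemma countably_generated_filter_finer_sequence:
  fixes A :: "nat \<Rightarrow> 'a set"
  assumes proper: "G \<noteq> bot" and A: "\<And>n. \<forall>\<^sub>F x in G. x \<in> A n"
  obtains x :: "nat \<Rightarrow> 'a" where "filtermap x frechet_filter \<le> (INF n. principal (A n))"
proof -
  have "\<exists>a. \<forall>k\<le>n. a \<in> A k" for n
  proof -
    have "\<forall>\<^sub>F a in G. \<forall>k\<in>{..n}. a \<in> A k"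
      using A by (intro eventually_ball_finite) auto
    then show ?thesis
      using eventually_happens proper by fastforce
  qed
  then obtain x where x: "\<And>n k. k \<le> n \<Longrightarrow> x n \<in> A k"
    by metis
  have "filtermap x frechet_filter \<le> principal (A k)" for k
    using x unfolding le_principal eventually_filtermap cofinite_eq_sequentially
    by (auto intro: eventually_sequentiallyI)
  then show thesis
    by (intro that INF_greatest)
qed

text \<open>
  The sequence found above has no reason to be finer than \<open>G\<close> itself, so its limit is carried over in two
  steps through the filter \<open>E\<close> generated by the small members: up from the sequence to the coarser \<open>E\<close>,
  which is Cauchy, and then down from \<open>E\<close> to the finer \<open>G\<close>.
\<close>

lemma sequentially_complete_imp_tvs_complete:
  assumes complete: "sequentially_complete TYPE('a::topological_ab_group_add)"
    and base: "countable_base_at_zero TYPE('a)"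
  shows "tvs_complete TYPE('a)"
  unfolding tvs_complete_def
proof (intro allI impI)
  fix G :: "'a filter"
  assume proper: "G \<noteq> bot" and cauchy: "tvs_cauchy_filter G"
  obtain \<B> :: "'a set set" where \<B>: "countable \<B>" "\<And>B. B \<in> \<B> \<Longrightarrow> neighborhood 0 B"
      "\<And>U. neighborhood 0 U \<Longrightarrow> \<exists>B\<in>\<B>. B \<subseteq> U"
    using base unfolding countable_base_at_zero_def by blast
  have "neighborhood 0 (UNIV :: 'a set)"
    by (simp add: neighborhood_iff_eventually_nhds)
  then have "\<B> \<noteq> {}"
    using \<B>(3) by blast
  then have range: "range (from_nat_into \<B>) = \<B>"
    using \<B>(1) by (rule range_from_nat_into)
  have "\<forall>n. \<exists>A. (\<forall>\<^sub>F x in G. x \<in> A) \<and> {a - b | a b. a \<in> A \<and> b \<in> A} \<subseteq> from_nat_into \<B> n"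
    using cauchy[unfolded tvs_cauchy_filter_def, rule_format, OF \<B>(2)] range
    by blast
  from choice[OF this] obtain A where A: "\<And>n. \<forall>\<^sub>F x in G. x \<in> A n"
      and small: "\<And>n. {a - b | a b. a \<in> A n \<and> b \<in> A n} \<subseteq> from_nat_into \<B> n"
    by blast
  define E where "E = (INF n. principal (A n))"
  have E_A: "\<forall>\<^sub>F x in E. x \<in> A n" for n
    unfolding E_def le_principal[symmetric] by (rule INF_lower) simp
  have cauchy_E: "tvs_cauchy_filter E"
    unfolding tvs_cauchy_filter_def
  proof (intro allI impI)
    fix U :: "'a set"
    assume "neighborhood 0 U"
    then obtain n where "from_nat_into \<B> n \<subseteq> U"
      using \<B>(3) range by (metis rangeE)
    then show "\<exists>A. (\<forall>\<^sub>F x in E. x \<in> A) \<and> {a - b | a b. a \<in> A \<and> b \<in> A} \<subseteq> U"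
      using E_A[of n] small[of n] by (intro exI[of _ "A n"]) simp
  qed
  obtain x where finer: "filtermap x frechet_filter \<le> E"
    using countably_generated_filter_finer_sequence[OF proper A] unfolding E_def .
  obtain y where y: "filter_limit (filtermap x frechet_filter) y"
    using complete tvs_cauchy_filter_mono[OF finer cauchy_E]
    unfolding sequentially_complete_def complete_over_iff by blast
  have "filter_limit E y"
    using cauchy_E finer _ y by (rule cauchy_filter_limit_of_finer) (simp add: filtermap_bot_iff)
  moreover have "G \<le> E"
    unfolding E_def using A by (intro INF_greatest) (simp add: le_principal)
  ultimately show "\<exists>z. filter_limit G z"
    using filter_limit_mono by blast
qed

theorem theorem3p4:
  fixes scale :: "'k::real_normed_field \<Rightarrow> 'a::{t2_space, topological_ab_group_add} \<Rightarrow> 'a"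
  assumes "topological_vector_space scale"
    and "countable_base_at_zero TYPE('a)"
  shows "(tvs_complete TYPE('a) \<longleftrightarrow> (\<forall>F. free_filter F \<longrightarrow> complete_over TYPE('a) F)) \<and>
    ((\<forall>F. free_filter F \<longrightarrow> complete_over TYPE('a) F) \<longleftrightarrow>
      (\<exists>F. free_filter F \<and> complete_over TYPE('a) F)) \<and>
    ((\<exists>F. free_filter F \<and> complete_over TYPE('a) F) \<longleftrightarrow> sequentially_complete TYPE('a))"
proof -
  let ?i = "tvs_complete TYPE('a)"
  let ?ii = "\<forall>F. free_filter F \<longrightarrow> complete_over TYPE('a) F"
  let ?iii = "\<exists>F. free_filter F \<and> complete_over TYPE('a) F"
  let ?iv = "sequentially_complete TYPE('a)"
  have "?i \<Longrightarrow> ?ii"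
    using tvs_complete_imp_complete_over unfolding free_filter_def by blast
  moreover have "?ii \<Longrightarrow> ?iii"
    using free_filter_frechet by blast
  moreover have "?iii \<Longrightarrow> ?iv"
    using complete_over_finer_imp_complete_over
    unfolding free_filter_def sequentially_complete_def by blast
  moreover have "?iv \<Longrightarrow> ?i"
    using sequentially_complete_imp_tvs_complete assms(2) by blast
  ultimately show ?thesis
    by argo
qed

end
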